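(* Assume that each $L_i$ ($1\le i\le d$) is prefix-closed. Let $\mathbb{K}$ be a semiring and $f\colon\mathbb{N}^d\to\mathbb{K}$. If the $\mathbb{K}$-submodule $\langle\ker_{\boldsymbol{\mathcal{S}}}(f)\rangle_{\mathbb{K}}$ of $\mathbb{K}^{\mathbb{N}^d}$ is finitely generated, then $f$ is $(\boldsymbol{\mathcal{S}},\mathbb{K})$-regular. If $f$ is $(\boldsymbol{\mathcal{S}},\mathbb{K})$-regular and moreover $\mathbb{K}$ is finite or is a commutative ring, then $\langle\ker_{\boldsymbol{\mathcal{S}}}(f)\rangle_{\mathbb{K}}$ is finitely generated.
   Context: An abstract numeration system is a triple $\mathcal{S}=(L,A,<)$ where $L$ is an infinite regular language over a finite alphabet $A$ totally ordered by $<$. Words are ordered by the radix order ($u<_{\rm rad}v$ iff $|u|<|v|$, or $|u|=|v|$ and $u$ is lexicographically smaller); $\mathrm{rep}_{\mathcal{S}}\colon\mathbb{N}\to L$ maps $n$ to the $n$-th word of $L$ (indexing from $0$) and $\mathrm{val}_{\mathcal{S}}$ is its inverse. Fix $d\ge1$, abstract numeration systems $\mathcal{S}_i=(L_i,A_i,<_i)$ for $i\in\{1,\dots,d\}$, $\boldsymbol{\mathcal{S}}=(\mathcal{S}_1,\dots,\mathcal{S}_d)$, and a symbol $\#\notin A_1\cup\dots\cup A_d$. Let $\boldsymbol{\#}=(\#,\dots,\#)$ and $\boldsymbol{A}=\big((A_1\cup\{\#\})\times\cdots\times(A_d\cup\{\#\})\big)\setminus\{\boldsymbol{\#}\}$.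 For words $w_1,\dots,w_d$, $(w_1,\dots,w_d)^\#$ is the word over $\boldsymbol{A}$ obtained by left-padding each $w_i$ with $\#$'s to the maximal length and reading them in parallel. Let $\boldsymbol{L}=\{(w_1,\dots,w_d)^\#: w_i\in L_i\}$, $\mathrm{rep}_{\boldsymbol{\mathcal{S}}}(n_1,\dots,n_d)=(\mathrm{rep}_{\mathcal{S}_1}(n_1),\dots,\mathrm{rep}_{\mathcal{S}_d}(n_d))^\#$ (a bijection $\mathbb{N}^d\to\boldsymbol{L}$), $\mathrm{val}_{\boldsymbol{\mathcal{S}}}$ its inverse. A series $S\colon A^*\to\mathbb{K}$ is $\mathbb{K}$-recognizable if there exist $r\ge1$, a monoid morphism $\mu\colon A^*\to\mathbb{K}^{r\times r}$, $\lambda\in\mathbb{K}^{1\times r}$, $\gamma\in\mathbb{K}^{r\times1}$ with $(S,w)=\lambda\mu(w)\gamma$ for all $w$. A sequence $f\colon\mathbb{N}^d\to\mathbb{K}$ is $(\boldsymbol{\mathcal{S}},\mathbb{K})$-regular if the series $\sum_{\boldsymbol{w}\in\boldsymbol{L}}f(\mathrm{val}_{\boldsymbol{\mathcal{S}}}(\boldsymbol{w}))\,\boldsymbol{w}$ over $\boldsymbol{A}$ is $\mathbb{K}$-recognizable. For $\boldsymbol{w}\in\boldsymbol{A}^*$, $(f\circ\boldsymbol{w})(\boldsymbol{n})=f(\mathrm{val}_{\boldsymbol{\mathcal{S}}}(\mathrm{rep}_{\boldsymbol{\mathcal{S}}}(\boldsymbol{n})\boldsymbol{w}))$ if the concatenation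 $\mathrm{rep}_{\boldsymbol{\mathcal{S}}}(\boldsymbol{n})\boldsymbol{w}$ lies in $\boldsymbol{L}$, and $0$ otherwise. The $\boldsymbol{\mathcal{S}}$-kernel of $f$ is $\ker_{\boldsymbol{\mathcal{S}}}(f)=\{f\circ\boldsymbol{w}:\boldsymbol{w}\in\boldsymbol{A}^*\}$, and $\langle\ker_{\boldsymbol{\mathcal{S}}}(f)\rangle_{\mathbb{K}}$ is the $\mathbb{K}$-submodule of $\mathbb{K}^{\mathbb{N}^d}$ it generates. *)

theory Defs
  imports "Jordan_Normal_Form.Matrix" "HOL-Library.Sublist"
begin

section \<open>Abstract numeration systems\<close>

definition regular_language :: "'a set \<Rightarrow> 'a list set \<Rightarrow> bool" where
  "regular_language A L \<longleftrightarrow>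
     (\<exists>(n::nat) \<delta> q0 F. q0 < n \<and> (\<forall>q<n. \<forall>a\<in>A. \<delta> q a < n) \<and> F \<subseteq> {..<n} \<and>
        L = {w \<in> lists A. foldl \<delta> q0 w \<in> F})"

record 'a numeration_system =
  lang :: "'a list set"
  alph :: "'a set"
  alph_less :: "('a \<times> 'a) set"

definition abstract_numeration_system :: "'a numeration_system \<Rightarrow> bool" where
  "abstract_numeration_system S \<longleftrightarrow>
     finite (alph S) \<and>
     alph_less S \<subseteq> alph S \<times> alph S \<and> strict_linear_order_on (alph S) (alph_less S) \<and>
     regular_language (alph S) (lang S) \<and> infinite (lang S)"

text \<open>The relation \<^term>\<open>lenlex r\<close> is the radix order induced by the strict order \<^term>\<open>r\<close>.
  The \<open>n\<close>-th word of the language is the one having exactly \<open>n\<close> predecessors in the language;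
  over a finite alphabet each word has only finitely many predecessors, so the cardinality
  is meaningful.\<close>

definition rep :: "'a numeration_system \<Rightarrow> nat \<Rightarrow> 'a list" where
  "rep S n = (THE w. w \<in> lang S \<and> card {u \<in> lang S. (u, w) \<in> lenlex (alph_less S)} = n)"

definition prefix_closed :: "'a list set \<Rightarrow> bool" where
  "prefix_closed L \<longleftrightarrow> (\<forall>w\<in>L. \<forall>u. prefix u w \<longrightarrow> u \<in> L)"


section \<open>Multidimensional numeration systems\<close>

text \<open>The dimension \<open>d\<close> is the cardinality of the finite (hence nonempty) index type \<open>'d\<close>.
  The parameter \<open>h\<close> is the padding symbol. All the alphabets live in one common type \<open>'a\<close>.\<close>

definition padded_alphabet :: "'a \<Rightarrow> ('d \<Rightarrow> 'a numeration_system) \<Rightarrow> ('d \<Rightarrow> 'a) set" where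
  "padded_alphabet h S = {x. \<forall>i. x i \<in> alph (S i) \<union> {h}} - {\<lambda>_. h}"

definition parallel :: "'a \<Rightarrow> ('d::finite \<Rightarrow> 'a list) \<Rightarrow> ('d \<Rightarrow> 'a) list" where
  "parallel h w =
     (let m = Max (range (\<lambda>i. length (w i)));
          p = (\<lambda>i. replicate (m - length (w i)) h @ w i)
      in map (\<lambda>j i. p i ! j) [0..<m])"

definition multi_lang :: "'a \<Rightarrow> ('d::finite \<Rightarrow> 'a numeration_system) \<Rightarrow> ('d \<Rightarrow> 'a) list set" where
  "multi_lang h S = {parallel h w | w. \<forall>i. w i \<in> lang (S i)}"

definition multi_rep ::
    "'a \<Rightarrow> ('d::finite \<Rightarrow> 'a numeration_system) \<Rightarrow> ('d \<Rightarrow> nat) \<Rightarrow> ('d \<Rightarrow> 'a) list" where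
  "multi_rep h S n = parallel h (\<lambda>i. rep (S i) (n i))"

definition multi_val ::
    "'a \<Rightarrow> ('d::finite \<Rightarrow> 'a numeration_system) \<Rightarrow> ('d \<Rightarrow> 'a) list \<Rightarrow> ('d \<Rightarrow> nat)" where
  "multi_val h S = inv_into UNIV (multi_rep h S)"


section \<open>Recognizable series and regular sequences\<close>

text \<open>Semirings are not required to satisfy \<open>0 \<noteq> 1\<close>, hence the sort
  \<open>{semiring_0, monoid_mult}\<close> in place of \<open>semiring_1\<close>.
  A series over \<open>A\<close> is represented by a function of which only the values
  on \<^term>\<open>lists A\<close> matter.\<close>

definition recognizable ::
    "'b set \<Rightarrow> ('b list \<Rightarrow> 'k::{semiring_0,monoid_mult}) \<Rightarrow> bool" where
  "recognizable A s \<longleftrightarrow>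
     (\<exists>r\<ge>1. \<exists>(\<mu> :: 'b list \<Rightarrow> 'k mat) \<Lambda> \<gamma>.
        (\<forall>w\<in>lists A. \<mu> w \<in> carrier_mat r r) \<and>
        \<mu> [] = 1\<^sub>m r \<and>
        (\<forall>u\<in>lists A. \<forall>v\<in>lists A. \<mu> (u @ v) = \<mu> u * \<mu> v) \<and>
        \<Lambda> \<in> carrier_mat 1 r \<and> \<gamma> \<in> carrier_mat r 1 \<and>
        (\<forall>w\<in>lists A. s w = (\<Lambda> * \<mu> w * \<gamma>) $$ (0, 0)))"

definition regular_sequence ::
    "'a \<Rightarrow> ('d::finite \<Rightarrow> 'a numeration_system) \<Rightarrow>
     (('d \<Rightarrow> nat) \<Rightarrow> 'k::{semiring_0,monoid_mult}) \<Rightarrow> bool" where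
  "regular_sequence h S f \<longleftrightarrow>
     recognizable (padded_alphabet h S)
       (\<lambda>w. if w \<in> multi_lang h S then f (multi_val h S w) else 0)"


section \<open>The kernel of a sequence\<close>

definition shift_seq ::
    "'a \<Rightarrow> ('d::finite \<Rightarrow> 'a numeration_system) \<Rightarrow>
     (('d \<Rightarrow> nat) \<Rightarrow> 'k::zero) \<Rightarrow> ('d \<Rightarrow> 'a) list \<Rightarrow> (('d \<Rightarrow> nat) \<Rightarrow> 'k)" where
  "shift_seq h S f w =
     (\<lambda>n. if multi_rep h S n @ w \<in> multi_lang h S
          then f (multi_val h S (multi_rep h S n @ w)) else 0)"

definition seq_kernel ::
    "'a \<Rightarrow> ('d::finite \<Rightarrow> 'a numeration_system) \<Rightarrow>
     (('d \<Rightarrow> nat) \<Rightarrow> 'k::zero) \<Rightarrow> (('d \<Rightarrow> nat) \<Rightarrow> 'k) set" where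
  "seq_kernel h S f = {shift_seq h S f w | w. w \<in> lists (padded_alphabet h S)}"

text \<open>Scalars act on sequences from the right. Over a commutative semiring the side is
  irrelevant. Over a noncommutative one, it is dictated by the conventions for recognizability
  and for the kernel: the kernel acts by appending \<open>w\<close> on the right, and
  \<open>\<Lambda> \<mu>(u w) \<gamma> = (\<Lambda> \<mu>(u)) (\<mu>(w) \<gamma>)\<close> is a combination of the sequences
  given by the entries of \<open>\<Lambda> \<mu>(u)\<close> with the entries of \<open>\<mu>(w) \<gamma>\<close> as right coefficients.\<close>

definition is_submodule :: "('n \<Rightarrow> 'k::{semiring_0,monoid_mult}) set \<Rightarrow> bool" where
  "is_submodule M \<longleftrightarrow>
     (\<lambda>_. 0) \<in> M \<and>
     (\<forall>g\<in>M. \<forall>g'\<in>M. (\<lambda>n. g n + g' n) \<in> M) \<and>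
     (\<forall>g\<in>M. \<forall>c. (\<lambda>n. g n * c) \<in> M)"

definition submodule_span ::
    "('n \<Rightarrow> 'k::{semiring_0,monoid_mult}) set \<Rightarrow> ('n \<Rightarrow> 'k) set" where
  "submodule_span X = is_submodule hull X"

definition finitely_generated :: "('n \<Rightarrow> 'k::{semiring_0,monoid_mult}) set \<Rightarrow> bool" where
  "finitely_generated M \<longleftrightarrow> (\<exists>G. finite G \<and> M = submodule_span G)"

end

theory Submission
  imports Defs
begin

text \<open>The letter shifts \<open>g \<mapsto> g \<circ> a\<close> are linear and, the numeration languages being prefix-closed,
  satisfy \<open>(g \<circ> w) \<circ> a = g \<circ> (a w)\<close>. So they act on the span of the kernel, and writing the
  images of finitely many generators in terms of the generators gives the matrices of a linear
  representation.

  Conversely, a representation \<open>(\<Lambda>, \<mu>, \<gamma>)\<close> yields \<open>f \<circ> w = \<Sum>\<^sub>i g\<^sub>i (\<mu>(w) \<gamma>)\<^sub>i\<close> with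
  \<open>g\<^sub>i(n) = (\<Lambda> \<mu>(rep n))\<^sub>i\<close>. If \<open>K\<close> is finite, so is the kernel. A commutative ring \<open>K\<close> need not
  be Noetherian, but all the coefficients \<open>(\<mu>(w) \<gamma>)\<^sub>i\<close> lie in the subring generated by the
  finitely many entries of \<open>\<gamma>\<close> and of the matrices of the letters. The module generated by the
  \<open>g\<^sub>i\<close> over this subring is Noetherian by Hilbert's basis theorem, hence the
  kernel generates a finitely generated module already over the subring.\<close>

section \<open>Modules over finitely generated rings of scalars\<close>

text \<open>Closure under \<open>C\<close> is iterated, so a closed set is a module over the whole
  subsemiring generated by \<open>C\<close>, without this subsemiring being named.
  \<open>C = UNIV\<close> gives the submodules.\<close>

definition scalar_closed :: "'k set \<Rightarrow> ('n \<Rightarrow> 'k::{semiring_0,monoid_mult}) set \<Rightarrow> bool" where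
  "scalar_closed C M \<longleftrightarrow>
     (\<lambda>_. 0) \<in> M \<and>
     (\<forall>g\<in>M. \<forall>g'\<in>M. (\<lambda>n. g n + g' n) \<in> M) \<and>
     (\<forall>g\<in>M. \<forall>c\<in>C. (\<lambda>n. g n * c) \<in> M)"

lemma is_submodule_eq: "is_submodule = scalar_closed UNIV"
  by (simp add: fun_eq_iff is_submodule_def scalar_closed_def)

lemma scalar_closedI:
  assumes "(\<lambda>_. 0) \<in> M"
    and "\<And>g g'. g \<in> M \<Longrightarrow> g' \<in> M \<Longrightarrow> (\<lambda>n. g n + g' n) \<in> M"
    and "\<And>g c. g \<in> M \<Longrightarrow> c \<in> C \<Longrightarrow> (\<lambda>n. g n * c) \<in> M"
  shows "scalar_closed C M"
  using assms by (simp add: scalar_closed_def)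

lemma scalar_closed_zero: "scalar_closed C M \<Longrightarrow> (\<lambda>_. 0) \<in> M"
  and scalar_closed_add: "scalar_closed C M \<Longrightarrow> g \<in> M \<Longrightarrow> g' \<in> M \<Longrightarrow> (\<lambda>n. g n + g' n) \<in> M"
  and scalar_closed_scale: "scalar_closed C M \<Longrightarrow> g \<in> M \<Longrightarrow> c \<in> C \<Longrightarrow> (\<lambda>n. g n * c) \<in> M"
  by (simp_all add: scalar_closed_def)

lemma scalar_closed_sum:
  assumes "scalar_closed C M" "\<And>i. i < (r::nat) \<Longrightarrow> g i \<in> M"
  shows "(\<lambda>n. \<Sum>i<r. g i n) \<in> M"
  using assms(2) by (induction r) (auto intro: scalar_closed_zero scalar_closed_add assms(1))

lemma scalar_closed_mono: "C \<subseteq> D \<Longrightarrow> scalar_closed D M \<Longrightarrow> scalar_closed C M"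
  by (auto simp: scalar_closed_def)

lemma scalar_closed_hull: "scalar_closed C (scalar_closed C hull X)"
  by (rule hull_in) (auto simp: scalar_closed_def)

lemma scalar_closed_hull_least: "X \<subseteq> M \<Longrightarrow> scalar_closed C M \<Longrightarrow> scalar_closed C hull X \<subseteq> M"
  by (rule hull_minimal)

lemma submodule_span_closed: "scalar_closed UNIV (submodule_span X)"
  by (simp add: submodule_span_def is_submodule_eq scalar_closed_hull)

lemma submodule_span_base: "X \<subseteq> submodule_span X"
  by (simp add: submodule_span_def hull_subset)

lemma submodule_span_least: "X \<subseteq> M \<Longrightarrow> scalar_closed UNIV M \<Longrightarrow> submodule_span X \<subseteq> M"
  unfolding submodule_span_def is_submodule_eq by (rule hull_minimal)

text \<open>The linear combinations of the \<open>b i\<close> are themselves a submodule: a further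
  scalar on the right is absorbed into the coefficients by associativity.\<close>

lemma submodule_span_finite_coeffs:
  assumes "g \<in> submodule_span (b ` {..<r::nat})"
  shows "\<exists>c. g = (\<lambda>n. \<Sum>i<r. b i n * c i)"
proof -
  have "submodule_span (b ` {..<r}) \<subseteq> {g. \<exists>c. g = (\<lambda>n. \<Sum>i<r. b i n * c i)}"
  proof (rule submodule_span_least)
    have unit: "b k = (\<lambda>n. \<Sum>i<r. b i n * (if i = k then 1 else 0))" if "k < r" for k
    proof
      fix n
      have "(\<Sum>i<r. b i n * (if i = k then 1 else 0)) = (\<Sum>i<r. if i = k then b i n else 0)"
        by (rule sum.cong) auto
      then show "b k n = (\<Sum>i<r. b i n * (if i = k then 1 else 0))"
        using that by simp
    qed
    show "b ` {..<r} \<subseteq> {g. \<exists>c. g = (\<lambda>n. \<Sum>i<r. b i n * c i)}"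
      by (intro image_subsetI CollectI exI) (erule unit[OF lessThan_iff[THEN iffD1]])
    have I: "(\<lambda>n. \<Sum>i<r. b i n * c i) \<in> {g. \<exists>c. g = (\<lambda>n. \<Sum>i<r. b i n * c i)}" for c
      by blast
    show "scalar_closed UNIV {g. \<exists>c. g = (\<lambda>n. \<Sum>i<r. b i n * c i)}"
    proof (rule scalar_closedI; (elim CollectE exE)?; hypsubst?)
      show "(\<lambda>_. 0) \<in> {g. \<exists>c. g = (\<lambda>n. \<Sum>i<r. b i n * c i)}"
        using I[of "\<lambda>_. 0"] by simp
    next
      fix c c'
      show "(\<lambda>n. (\<Sum>i<r. b i n * c i) + (\<Sum>i<r. b i n * c' i))
          \<in> {g. \<exists>c. g = (\<lambda>n. \<Sum>i<r. b i n * c i)}"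
        using I[of "\<lambda>i. c i + c' i"] by (simp only: distrib_left sum.distrib)
    next
      fix c x
      show "(\<lambda>n. (\<Sum>i<r. b i n * c i) * x) \<in> {g. \<exists>c. g = (\<lambda>n. \<Sum>i<r. b i n * c i)}"
        using I[of "\<lambda>i. c i * x"] by (simp only: sum_distrib_right mult.assoc)
    qed
  qed
  with assms show ?thesis by blast
qed

section \<open>Noetherian modules over the integers\<close>

definition noetherian :: "'k set \<Rightarrow> ('n \<Rightarrow> 'k::{semiring_0,monoid_mult}) set \<Rightarrow> bool" where
  "noetherian C M \<longleftrightarrow>
     (\<forall>N\<subseteq>M. scalar_closed C N \<longrightarrow> (\<exists>G. finite G \<and> G \<subseteq> N \<and> N \<subseteq> scalar_closed C hull G))"

lemma noetherianD:
  assumes "noetherian C M" "N \<subseteq> M" "scalar_closed C N"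
  obtains G where "finite G" "G \<subseteq> N" "N \<subseteq> scalar_closed C hull G"
  using assms by (auto simp: noetherian_def)

text \<open>Values at \<open>x\<close> of the polynomials of degree less than \<open>d\<close> with
  coefficients in \<open>X\<close>. Since they are values and not formal polynomials, coefficients
  need not be unique.\<close>

primrec bounded_degree ::
    "('n \<Rightarrow> 'k::{semiring_0,monoid_mult}) set \<Rightarrow> 'k \<Rightarrow> nat \<Rightarrow> ('n \<Rightarrow> 'k) set" where
  "bounded_degree X x 0 = {\<lambda>_. 0}"
| "bounded_degree X x (Suc d) =
     {\<lambda>n. p n + m n * x ^ d | p m. p \<in> bounded_degree X x d \<and> m \<in> X}"

text \<open>The element \<open>e\<close> serves as minus one, so subtraction becomes addition of a
  multiple by \<open>e\<close>. Closure under a set of scalars containing \<open>e\<close> then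
  yields additive groups.\<close>

locale commutative_scalars =
  fixes e :: "'k::{semiring_0,monoid_mult}"
  assumes commute: "\<And>x y :: 'k. x * y = y * x"
    and one_plus_e: "1 + e = 0"
begin

lemma right_commute: "x * y * z = x * z * y" for x y z :: 'k
  by (metis commute mult.assoc)

lemma plus_neg: "x + x * e = 0"
  by (metis distrib_left mult_1_right mult_zero_right one_plus_e)

lemma plus_neg_cancel: "x + (y + x * e) = y"
  by (metis add.left_commute add.right_neutral plus_neg)

text \<open>Both \<open>1\<close> and \<open>e * e\<close> are additive inverses of
  \<open>e\<close>.\<close>

lemma e_e: "e * e = 1"
  by (metis add.assoc add.commute add.left_neutral mult_1_left one_plus_e plus_neg)

lemma e_e_cancel: "x * e * e = x"
  by (simp add: mult.assoc e_e)

text \<open>The class of \<open>'k\<close> admits neither \<open>of_nat\<close> nor \<open>of_int\<close>, so an integer is represented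
  by its positive and negative parts and the multiples of \<open>x\<close> are written as sums.\<close>

lemma nat_multiples_cancel:
  "l \<le> k \<Longrightarrow> (\<Sum>i<k. x) + (\<Sum>i<l. x * e) = (\<Sum>i<k - l. x)" for k l :: nat and x :: 'k
proof (induction l arbitrary: k)
  case (Suc l)
  then obtain k' where k: "k = Suc k'" "l \<le> k'"
    by (metis Suc_le_D Suc_le_mono)
  have "(\<Sum>i<k. x) + (\<Sum>i<Suc l. x * e) = ((\<Sum>i<k'. x) + (\<Sum>i<l. x * e)) + (x + x * e)"
    by (simp add: k add_ac)
  also have "\<dots> = (\<Sum>i<k' - l. x)"
    using Suc.IH[OF k(2)] by (simp add: plus_neg)
  finally show ?case using k by simp
qed simp

text \<open>Sets closed under the single scalar \<open>e\<close> are abelian groups. Modulo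
  \<open>E\<close>, the integer multiples of \<open>g\<close> occurring in \<open>N\<close> come
  from a subgroup of the integers, which has one generator. A lift of it and generators of the part
  of \<open>N\<close> spanned by \<open>E\<close> generate \<open>N\<close>.\<close>

lemma noetherian_insert_generator:
  fixes X :: "('n \<Rightarrow> 'k) set"
  assumes noeth: "noetherian {e} (scalar_closed {e} hull E)"
  shows "noetherian {e} (scalar_closed {e} hull (insert g E))"
  unfolding noetherian_def
proof (intro allI impI)
  define X where "X = scalar_closed {e} hull E"
  have X: "scalar_closed {e} X" by (simp add: X_def scalar_closed_hull)
  fix N assume sub: "N \<subseteq> scalar_closed {e} hull (insert g E)" and N: "scalar_closed {e} N"
  \<comment> \<open>The pair \<open>k\<close>, \<open>l\<close> encodes the integer coefficient
    \<open>k - l\<close> of \<open>g\<close>; multiplication by \<open>e\<close> swaps the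
    two.\<close>
  have "scalar_closed {e} hull (insert g E)
     \<subseteq> {\<lambda>n. x n + ((\<Sum>i<k. g n) + (\<Sum>i<l. g n * e)) | x (k::nat) (l::nat). x \<in> X}" (is "_ \<subseteq> ?Y")
  proof (rule scalar_closed_hull_least)
    have YI: "(\<lambda>n. x n + ((\<Sum>i<k. g n) + (\<Sum>i<l. g n * e))) \<in> ?Y"
      if "x \<in> X" for x and k l :: nat
      using that by blast
    have "g \<in> ?Y"
      using YI[OF scalar_closed_zero[OF X], of 1 0] by simp
    moreover have "x \<in> ?Y" if "x \<in> E" for x
      using YI[of x 0 0] that by (simp add: X_def hull_inc)
    ultimately show "insert g E \<subseteq> ?Y" by blast
    show "scalar_closed {e} ?Y"
    proof (rule scalar_closedI)
      show "(\<lambda>_. 0) \<in> ?Y"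
        using YI[OF scalar_closed_zero[OF X], of 0 0] by simp
    next
      fix p q assume "p \<in> ?Y" "q \<in> ?Y"
      from \<open>p \<in> ?Y\<close> obtain x and k l :: nat
        where p: "p = (\<lambda>n. x n + ((\<Sum>i<k. g n) + (\<Sum>i<l. g n * e)))" "x \<in> X"
        by (elim CollectE exE conjE) (rule that)
      from \<open>q \<in> ?Y\<close> obtain y and k' l' :: nat
        where q: "q = (\<lambda>n. y n + ((\<Sum>i<k'. g n) + (\<Sum>i<l'. g n * e)))" "y \<in> X"
        by (elim CollectE exE conjE) (rule that)
      have add: "(\<Sum>i<a + b. z) = (\<Sum>i<a. z) + (\<Sum>i<b. z)" for a b :: nat and z :: 'k
        by (induction a) (simp_all add: add_ac)
      have "(\<lambda>n. p n + q n) =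
          (\<lambda>n. (x n + y n) + ((\<Sum>i<k + k'. g n) + (\<Sum>i<l + l'. g n * e)))"
        by (simp add: p(1) q(1) add add_ac)
      with scalar_closed_add[OF X p(2) q(2)] show "(\<lambda>n. p n + q n) \<in> ?Y"
        using YI by simp
    next
      fix p c assume "p \<in> ?Y" and c: "c \<in> {e}"
      from \<open>p \<in> ?Y\<close> obtain x and k l :: nat
        where p: "p = (\<lambda>n. x n + ((\<Sum>i<k. g n) + (\<Sum>i<l. g n * e)))" "x \<in> X"
        by (elim CollectE exE conjE) (rule that)
      have "(\<lambda>n. p n * c) = (\<lambda>n. x n * e + ((\<Sum>i<l. g n) + (\<Sum>i<k. g n * e)))"
        using c by (simp add: p(1) distrib_right sum_distrib_right e_e_cancel add_ac)
      with scalar_closed_scale[OF X p(2), of e] show "(\<lambda>n. p n * c) \<in> ?Y"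
        using YI by simp
    qed
  qed
  then have N_Y: "N \<subseteq> ?Y" using sub by (rule subset_trans[rotated])
  have N_neg: "(\<lambda>n. p n * e) \<in> N" if "p \<in> N" for p
    using scalar_closed_scale[OF N that] by simp
  have X_neg: "(\<lambda>n. p n * e) \<in> X" if "p \<in> X" for p
    using scalar_closed_scale[OF X that] by simp
  \<comment> \<open>The nonnegative part of the subgroup of coefficients of
    \<open>g\<close>.\<close>
  define I where "I = {k::nat. \<exists>x\<in>X. (\<lambda>n. x n + (\<Sum>i<k. g n)) \<in> N}"
  have II: "k \<in> I" if "x \<in> X" "(\<lambda>n. x n + (\<Sum>i<k. g n)) \<in> N" for x k
    unfolding I_def using that by blast
  have NX: "scalar_closed {e} (N \<inter> X)"
    using N X by (auto simp: scalar_closed_def)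
  have "N \<inter> X \<subseteq> scalar_closed {e} hull E" by (simp add: X_def)
  from noeth this NX obtain G0
    where G0: "finite G0" "G0 \<subseteq> N \<inter> X" "N \<inter> X \<subseteq> scalar_closed {e} hull G0"
    by (rule noetherianD)
  \<comment> \<open>Elements with a nonnegative multiple of \<open>g\<close> come first; those with
    a negative one are reduced to them by a sign change.\<close>
  have "\<exists>G. finite G \<and> G0 \<subseteq> G \<and> G \<subseteq> N \<and>
      (\<forall>k::nat. \<forall>x\<in>X. (\<lambda>n. x n + (\<Sum>i<k. g n)) \<in> N \<longrightarrow>
          (\<lambda>n. x n + (\<Sum>i<k. g n)) \<in> scalar_closed {e} hull G)"
  proof (cases "\<exists>k\<in>I. 0 < k")
    case False
    then have k: "k = 0" if "x \<in> X" "(\<lambda>n. x n + (\<Sum>i<k. g n)) \<in> N" for x and k :: nat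
      using II[OF that] by simp
    have "(\<lambda>n. x n + (\<Sum>i<k. g n)) \<in> scalar_closed {e} hull G0"
      if "x \<in> X" "(\<lambda>n. x n + (\<Sum>i<k. g n)) \<in> N" for x and k :: nat
      using k[OF that] that G0(3) by auto
    with G0 show ?thesis by (intro exI[of _ G0]) simp
  next
    case True
    \<comment> \<open>The least positive coefficient generates the subgroup; \<open>p0\<close> below
      is an element of \<open>N\<close> that attains it.\<close>
    define k0 where "k0 = (LEAST k. k \<in> I \<and> 0 < k)"
    have k0: "k0 \<in> I" "0 < k0"
      using LeastI_ex[of "\<lambda>k. k \<in> I \<and> 0 < k"] True by (auto simp: k0_def)
    have k0_least: "k = 0" if "k \<in> I" "k < k0" for k
      using not_less_Least[of k "\<lambda>k. k \<in> I \<and> 0 < k"] that by (auto simp: k0_def)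
    obtain x0 where x0: "x0 \<in> X" "(\<lambda>n. x0 n + (\<Sum>i<k0. g n)) \<in> N"
      using k0(1) by (auto simp: I_def)
    define p0 where "p0 = (\<lambda>n. x0 n + (\<Sum>i<k0. g n))"
    have p0: "p0 \<in> N" using x0(2) by (simp add: p0_def)
    define H where "H = scalar_closed {e} hull (insert p0 G0)"
    have H: "scalar_closed {e} H" by (simp add: H_def scalar_closed_hull)
    have G0_H: "N \<inter> X \<subseteq> H"
      using G0(3) hull_mono[of G0 "insert p0 G0"] unfolding H_def by blast
    \<comment> \<open>Division with remainder by repeated subtraction of \<open>p0\<close>: a
      remainder below \<open>k0\<close> is again a coefficient, hence zero, and the element then
      lies in \<open>N \<inter> X\<close>.\<close>
    have "(\<lambda>n. x n + (\<Sum>i<k. g n)) \<in> N \<Longrightarrow> (\<lambda>n. x n + (\<Sum>i<k. g n)) \<in> H"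
      if "x \<in> X" for x and k :: nat using that
    proof (induction k arbitrary: x rule: less_induct)
      case (less k)
      show ?case
      proof (cases "k < k0")
        case True
        then have "k = 0" using less.prems by (intro k0_least II)
        then show ?thesis using less.prems G0_H by auto
      next
        case False
        define y where "y = (\<lambda>n. x n + x0 n * e)"
        have y: "y \<in> X"
          unfolding y_def by (intro scalar_closed_add[OF X] less.prems X_neg x0)
        have eq: "(\<lambda>n. y n + (\<Sum>i<k - k0. g n)) = (\<lambda>n. (x n + (\<Sum>i<k. g n)) + p0 n * e)"
          using False by (simp add: nat_multiples_cancel[symmetric] y_def p0_def distrib_right
              sum_distrib_right add_ac)
        have "(\<lambda>n. y n + (\<Sum>i<k - k0. g n)) \<in> N"
          unfolding eq by (intro scalar_closed_add[OF N less.prems(1)] N_neg p0)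
        then have "(\<lambda>n. y n + (\<Sum>i<k - k0. g n)) \<in> H"
          using False k0(2) y by (intro less.IH) auto
        moreover have "p0 \<in> H" by (simp add: H_def hull_inc)
        ultimately have "(\<lambda>n. p0 n + (y n + (\<Sum>i<k - k0. g n))) \<in> H"
          by (rule scalar_closed_add[OF H, rotated])
        moreover have "p0 n + (y n + (\<Sum>i<k - k0. g n)) = x n + (\<Sum>i<k. g n)" for n
          using fun_cong[OF eq, of n] by (simp add: plus_neg_cancel)
        ultimately show ?thesis by simp
      qed
    qed
    then show ?thesis
      using G0 x0(2) unfolding H_def by (intro exI[of _ "insert p0 G0"]) (auto simp: p0_def)
  qed
  then obtain G where G: "finite G" "G0 \<subseteq> G" "G \<subseteq> N"
    and G_span: "\<forall>k::nat. \<forall>x\<in>X. (\<lambda>n. x n + (\<Sum>i<k. g n)) \<in> N \<longrightarrow>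
       (\<lambda>n. x n + (\<Sum>i<k. g n)) \<in> scalar_closed {e} hull G"
    by (elim exE conjE) (rule that)
  have "p \<in> scalar_closed {e} hull G" if p: "p \<in> N" for p
  proof -
    obtain x and k l :: nat where x: "p = (\<lambda>n. x n + ((\<Sum>i<k. g n) + (\<Sum>i<l. g n * e)))" "x \<in> X"
      using subsetD[OF N_Y p] by (elim CollectE exE conjE) (rule that)
    show ?thesis
    proof (cases "l \<le> k")
      case True
      then show ?thesis using G_span[rule_format, OF x(2)] p by (simp add: x(1) nat_multiples_cancel)
    next
      \<comment> \<open>Multiplication by \<open>e\<close> makes the coefficient the positive number
        \<open>l - k\<close>; a second multiplication restores \<open>p\<close> because
        \<open>e * e = 1\<close>.\<close>
      case False
      have eq: "(\<lambda>n. p n * e) = (\<lambda>n. x n * e + (\<Sum>i<l - k. g n))"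
        using False by (simp add: x(1) nat_multiples_cancel[symmetric] distrib_right
            sum_distrib_right e_e_cancel add_ac)
      have "(\<lambda>n. p n * e) \<in> scalar_closed {e} hull G"
        unfolding eq using N_neg[OF p] by (intro G_span[rule_format] X_neg x(2)) (simp add: eq)
      from scalar_closed_scale[OF scalar_closed_hull this, of e] show ?thesis
        by (simp add: e_e_cancel)
    qed
  qed
  then show "\<exists>G. finite G \<and> G \<subseteq> N \<and> N \<subseteq> scalar_closed {e} hull G"
    using G(1,3) by (intro exI[of _ G]) blast
qed

text \<open>Finitely generated abelian groups are Noetherian; this is the start of the induction
  over the scalars.\<close>

lemma noetherian_finite_generators:
  fixes E :: "('n \<Rightarrow> 'k) set"
  assumes "finite E"
  shows "noetherian {e} (scalar_closed {e} hull E)"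
  using assms
proof (induction E rule: finite_induct)
  case empty
  have "scalar_closed {e} hull {} \<subseteq> {\<lambda>_. 0 :: 'k}"
    by (rule scalar_closed_hull_least) (auto simp: scalar_closed_def)
  then show ?case
    unfolding noetherian_def
    using scalar_closed_zero[OF scalar_closed_hull] by (intro allI impI exI[of _ "{}"]) blast
qed (rule noetherian_insert_generator)

section \<open>Polynomial combinations and Hilbert's basis theorem\<close>

lemma bounded_degree_SucI:
  "p \<in> bounded_degree X x d \<Longrightarrow> m \<in> X \<Longrightarrow> (\<lambda>n. p n + m n * x ^ d) \<in> bounded_degree X x (Suc d)"
  by auto

text \<open>Commutativity moves a scalar past \<open>x ^ d\<close> into the coefficient.\<close>

lemma scalar_closed_bounded_degree:
  fixes X :: "('n \<Rightarrow> 'k) set"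
  assumes X: "scalar_closed C X"
  shows "scalar_closed C (bounded_degree X x d)"
proof (induction d)
  case 0
  show ?case by (auto simp: scalar_closed_def)
next
  case (Suc d)
  show ?case
  proof (rule scalar_closedI)
    show "(\<lambda>_. 0) \<in> bounded_degree X x (Suc d)"
      using bounded_degree_SucI[OF scalar_closed_zero[OF Suc.IH] scalar_closed_zero[OF X]] by simp
  next
    fix g g' assume "g \<in> bounded_degree X x (Suc d)" "g' \<in> bounded_degree X x (Suc d)"
    then obtain p m p' m' where *: "p \<in> bounded_degree X x d" "p' \<in> bounded_degree X x d"
        "m \<in> X" "m' \<in> X" "g = (\<lambda>n. p n + m n * x ^ d)" "g' = (\<lambda>n. p' n + m' n * x ^ d)"
      by auto
    show "(\<lambda>n. g n + g' n) \<in> bounded_degree X x (Suc d)"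
      using bounded_degree_SucI[OF scalar_closed_add[OF Suc.IH *(1,2)] scalar_closed_add[OF X *(3,4)]]
      by (simp only: *(5,6) distrib_right add_ac)
  next
    fix g c assume "g \<in> bounded_degree X x (Suc d)" and c: "c \<in> C"
    then obtain p m where *: "p \<in> bounded_degree X x d" "m \<in> X" "g = (\<lambda>n. p n + m n * x ^ d)"
      by auto
    show "(\<lambda>n. g n * c) \<in> bounded_degree X x (Suc d)"
      using bounded_degree_SucI[OF scalar_closed_scale[OF Suc.IH *(1) c] scalar_closed_scale[OF X *(2) c]]
      by (simp only: *(3) distrib_right right_commute[of _ c "x ^ d"])
  qed
qed

lemma bounded_degree_Suc_mono:
  fixes X :: "('n \<Rightarrow> 'k) set"
  assumes "scalar_closed C X"
  shows "bounded_degree X x d \<subseteq> bounded_degree X x (Suc d)"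
proof
  fix p assume "p \<in> bounded_degree X x d"
  then show "p \<in> bounded_degree X x (Suc d)"
    using bounded_degree_SucI[OF _ scalar_closed_zero[OF assms]] by fastforce
qed

lemma bounded_degree_shift:
  fixes X :: "('n \<Rightarrow> 'k) set"
  assumes X: "scalar_closed C X"
  shows "p \<in> bounded_degree X x d \<Longrightarrow> (\<lambda>n. p n * x) \<in> bounded_degree X x (Suc d)"
proof (induction d arbitrary: p)
  case 0
  then show ?case
    using scalar_closed_zero[OF scalar_closed_bounded_degree[OF X, of x 1]] by simp
next
  case (Suc d)
  then obtain q m where *: "q \<in> bounded_degree X x d" "m \<in> X" "p = (\<lambda>n. q n + m n * x ^ d)"
    by auto
  have "(\<lambda>n. p n * x) = (\<lambda>n. q n * x + m n * x ^ Suc d)"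
    by (simp only: *(3) power_Suc2 distrib_right mult.assoc)
  with bounded_degree_SucI[OF Suc.IH[OF *(1)] *(2)] show ?case by simp
qed

text \<open>Hilbert's basis theorem, by leading coefficients: \<open>Lead d\<close> below consists of the coefficients
  of \<open>x\<^sup>d\<close> of the elements of \<open>N\<close> having degree at most \<open>d\<close>.\<close>

lemma noetherian_insert_scalar:
  fixes E :: "('n \<Rightarrow> 'k) set"
  assumes noeth: "noetherian C (scalar_closed C hull E)" and e: "e \<in> C"
  shows "noetherian (insert x C) (scalar_closed (insert x C) hull E)"
  unfolding noetherian_def
proof (intro allI impI)
  define X where "X = scalar_closed C hull E"
  \<comment> \<open>\<open>P d\<close> has degrees strictly below \<open>d\<close>, so
    \<open>p + m * x ^ d\<close> with \<open>p\<close> in \<open>P d\<close> is a general element of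
    degree at most \<open>d\<close>.\<close>
  define P where "P = bounded_degree X x"
  have X: "scalar_closed C X" by (simp add: X_def scalar_closed_hull)
  have P: "scalar_closed C (P d)" for d
    unfolding P_def by (rule scalar_closed_bounded_degree[OF X])
  have P_Suc: "P d \<subseteq> P (Suc d)" for d
    unfolding P_def by (rule bounded_degree_Suc_mono[OF X])
  have P_mono: "P d \<subseteq> P d'" if "d \<le> d'" for d d'
    by (rule lift_Suc_mono_le[of P, OF P_Suc that])
  have P_shift: "(\<lambda>n. p n * x) \<in> P (Suc d)" if "p \<in> P d" for p d
    using that unfolding P_def by (rule bounded_degree_shift[OF X])
  fix N assume sub: "N \<subseteq> scalar_closed (insert x C) hull E" and N: "scalar_closed (insert x C) N"
  have N_C: "scalar_closed C N" using N by (rule scalar_closed_mono[rotated]) auto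
  \<comment> \<open>Every element is a polynomial in \<open>x\<close> over \<open>X\<close>. The
    generators are constants, hence in \<open>P 1\<close>, and multiplication by \<open>x\<close>
    raises the degree bound by one.\<close>
  have "scalar_closed (insert x C) hull E \<subseteq> (\<Union>d. P d)"
  proof (rule scalar_closed_hull_least)
    have "y \<in> P 1" if "y \<in> E" for y
      using that by (auto simp: P_def X_def hull_inc)
    then show "E \<subseteq> (\<Union>d. P d)" by blast
    show "scalar_closed (insert x C) (\<Union>d. P d)"
    proof (rule scalar_closedI)
      show "(\<lambda>_. 0) \<in> (\<Union>d. P d)" using scalar_closed_zero[OF P] by blast
    next
      fix g g' assume "g \<in> (\<Union>d. P d)" "g' \<in> (\<Union>d. P d)"
      then obtain d d' where "g \<in> P d" "g' \<in> P d'" by blast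
      then have "g \<in> P (max d d')" "g' \<in> P (max d d')"
        using P_mono by (meson max.cobounded1 max.cobounded2 subsetD)+
      then show "(\<lambda>n. g n + g' n) \<in> (\<Union>d. P d)" using scalar_closed_add[OF P] by blast
    next
      fix g c assume "g \<in> (\<Union>d. P d)" "c \<in> insert x C"
      then show "(\<lambda>n. g n * c) \<in> (\<Union>d. P d)" using P_shift scalar_closed_scale[OF P] by blast
    qed
  qed
  then have N_P: "N \<subseteq> (\<Union>d. P d)" using sub by blast
  define Lead where "Lead d = {m \<in> X. \<exists>p\<in>P d. (\<lambda>n. p n + m n * x ^ d) \<in> N}" for d
  have LeadI: "m \<in> Lead d" if "p \<in> P d" "m \<in> X" "(\<lambda>n. p n + m n * x ^ d) \<in> N" for p m d
    using that unfolding Lead_def by blast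
  have Lead: "scalar_closed C (Lead d)" for d
  proof (rule scalar_closedI)
    show "(\<lambda>_. 0) \<in> Lead d"
      using scalar_closed_zero[OF X] scalar_closed_zero[OF P] scalar_closed_zero[OF N]
      by (auto simp: Lead_def intro!: bexI[of _ "\<lambda>_. 0"])
  next
    fix g g' assume "g \<in> Lead d" "g' \<in> Lead d"
    then obtain p p' where *: "p \<in> P d" "p' \<in> P d" "g \<in> X" "g' \<in> X"
        "(\<lambda>n. p n + g n * x ^ d) \<in> N" "(\<lambda>n. p' n + g' n * x ^ d) \<in> N"
      by (auto simp: Lead_def)
    have "(\<lambda>n. (p n + p' n) + (g n + g' n) * x ^ d) \<in> N"
      using scalar_closed_add[OF N *(5,6)] by (simp only: distrib_right add_ac)
    then show "(\<lambda>n. g n + g' n) \<in> Lead d"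
      by (rule LeadI[OF scalar_closed_add[OF P *(1,2)] scalar_closed_add[OF X *(3,4)]])
  next
    fix g c assume "g \<in> Lead d" and c: "c \<in> C"
    then obtain p where *: "p \<in> P d" "g \<in> X" "(\<lambda>n. p n + g n * x ^ d) \<in> N"
      by (auto simp: Lead_def)
    have "(\<lambda>n. p n * c + g n * c * x ^ d) \<in> N"
      using scalar_closed_scale[OF N_C *(3) c] by (simp only: distrib_right right_commute[of _ c "x ^ d"])
    then show "(\<lambda>n. g n * c) \<in> Lead d"
      by (rule LeadI[OF scalar_closed_scale[OF P *(1) c] scalar_closed_scale[OF X *(2) c]])
  qed
  \<comment> \<open>Multiplication by \<open>x\<close> stays in \<open>N\<close> and keeps the
    leading coefficient.\<close>
  have "Lead d \<subseteq> Lead (Suc d)" for d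
  proof
    fix m assume "m \<in> Lead d"
    then obtain p where *: "p \<in> P d" "m \<in> X" "(\<lambda>n. p n + m n * x ^ d) \<in> N"
      by (auto simp: Lead_def)
    have "(\<lambda>n. p n * x + m n * x ^ Suc d) \<in> N"
      using scalar_closed_scale[OF N *(3), of x] by (simp add: power_Suc2 distrib_right mult.assoc del: power_Suc)
    then show "m \<in> Lead (Suc d)" by (rule LeadI[OF P_shift[OF *(1)] *(2)])
  qed
  then have Lead_mono: "Lead d \<subseteq> Lead d'" if "d \<le> d'" for d d'
    using that by (rule lift_Suc_mono_le[of Lead])
  have Union_Lead: "scalar_closed C (\<Union>d. Lead d)"
  proof (rule scalar_closedI)
    show "(\<lambda>_. 0) \<in> (\<Union>d. Lead d)" using scalar_closed_zero[OF Lead] by blast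
  next
    fix g g' assume "g \<in> (\<Union>d. Lead d)" "g' \<in> (\<Union>d. Lead d)"
    then obtain d d' where "g \<in> Lead d" "g' \<in> Lead d'" by blast
    then have "g \<in> Lead (max d d')" "g' \<in> Lead (max d d')"
      using Lead_mono by (meson max.cobounded1 max.cobounded2 subsetD)+
    then show "(\<lambda>n. g n + g' n) \<in> (\<Union>d. Lead d)" using scalar_closed_add[OF Lead] by blast
  next
    fix g c assume "g \<in> (\<Union>d. Lead d)" "c \<in> C"
    then show "(\<lambda>n. g n * c) \<in> (\<Union>d. Lead d)" using scalar_closed_scale[OF Lead] by blast
  qed
  have "(\<Union>d. Lead d) \<subseteq> scalar_closed C hull E"
    by (auto simp: Lead_def X_def)
  from noeth this Union_Lead obtain U where U: "finite U" "U \<subseteq> (\<Union>d. Lead d)"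
      "(\<Union>d. Lead d) \<subseteq> scalar_closed C hull U"
    by (rule noetherianD)
  \<comment> \<open>The finitely many generators of the union of the increasing chain all occur at
    one stage \<open>D\<close>, where the chain becomes stationary.\<close>
  obtain D where D: "U \<subseteq> Lead D"
  proof -
    from U(2) have "\<forall>m\<in>U. \<exists>d. m \<in> Lead d" by blast
    then obtain dg where "\<And>m. m \<in> U \<Longrightarrow> m \<in> Lead (dg m)" by metis
    then have "m \<in> Lead (Max (dg ` U))" if "m \<in> U" for m
      using that U(1) Lead_mono[of "dg m" "Max (dg ` U)"] by (meson Max_ge finite_imageI imageI subsetD)
    then show thesis using that by blast
  qed
  have Lead_D: "Lead d \<subseteq> Lead D" for d
    using U(3) scalar_closed_hull_least[OF D Lead] by blast
  have "\<exists>H. finite H \<and> H \<subseteq> Lead d \<and> Lead d \<subseteq> scalar_closed C hull H" for d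
  proof -
    have "Lead d \<subseteq> scalar_closed C hull E" by (auto simp: Lead_def X_def)
    from noeth this Lead obtain H
      where "finite H" "H \<subseteq> Lead d" "Lead d \<subseteq> scalar_closed C hull H"
      by (rule noetherianD)
    then show ?thesis by (intro exI conjI)
  qed
  then obtain H where H: "\<And>d. finite (H d)" "\<And>d. H d \<subseteq> Lead d"
      "\<And>d. Lead d \<subseteq> scalar_closed C hull H d"
    by metis
  \<comment> \<open>\<open>lift d m\<close> is a chosen element of \<open>N\<close> of degree at
    most \<open>d\<close> with leading coefficient \<open>m\<close>.\<close>
  define lift where
    "lift d m = (SOME g. g \<in> N \<and> (\<exists>p\<in>P d. g = (\<lambda>n. p n + m n * x ^ d)))" for d m
  have lift: "lift d m \<in> N \<and> (\<exists>p\<in>P d. lift d m = (\<lambda>n. p n + m n * x ^ d))"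
    if "m \<in> Lead d" for d m
  proof -
    have "\<exists>g. g \<in> N \<and> (\<exists>p\<in>P d. g = (\<lambda>n. p n + m n * x ^ d))"
      using that by (auto simp: Lead_def)
    from someI_ex[OF this] show ?thesis unfolding lift_def .
  qed
  define G where "G = (\<Union>d\<le>D. lift d ` H d)"
  define GH where "GH = scalar_closed (insert x C) hull G"
  have "finite G" using H(1) by (simp add: G_def)
  have "G \<subseteq> N" using lift H(2) unfolding G_def by blast
  then have GH_N: "GH \<subseteq> N" unfolding GH_def by (rule scalar_closed_hull_least[OF _ N])
  have GH: "scalar_closed (insert x C) GH" by (simp add: GH_def scalar_closed_hull)
  have GH_C: "scalar_closed C GH" using GH by (rule scalar_closed_mono[rotated]) auto
  \<comment> \<open>For \<open>d \<le> D\<close>, the leading coefficients in degree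
    \<open>d\<close> of elements of \<open>GH\<close> are closed under \<open>C\<close> and include
    the generators \<open>H d\<close>, hence all of \<open>Lead d\<close>.\<close>
  have low: "\<exists>p\<in>P d. (\<lambda>n. p n + m n * x ^ d) \<in> GH" if "d \<le> D" "m \<in> Lead d" for d m
  proof -
    define M where "M = {m. \<exists>p\<in>P d. (\<lambda>n. p n + m n * x ^ d) \<in> GH}"
    have MI: "m \<in> M" if "p \<in> P d" "(\<lambda>n. p n + m n * x ^ d) \<in> GH" for p m
      using that unfolding M_def by blast
    have "scalar_closed C hull H d \<subseteq> M"
    proof (rule scalar_closed_hull_least)
      have "\<exists>p\<in>P d. (\<lambda>n. p n + m n * x ^ d) \<in> GH" if m: "m \<in> H d" for m
      proof -
        have "lift d m \<in> GH" using m \<open>d \<le> D\<close> unfolding GH_def G_def by (intro hull_inc) auto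
        moreover obtain p where "p \<in> P d" "lift d m = (\<lambda>n. p n + m n * x ^ d)"
          using lift m H(2) by blast
        ultimately show ?thesis by auto
      qed
      then show "H d \<subseteq> M" unfolding M_def by blast
      show "scalar_closed C M"
      proof (rule scalar_closedI)
        show "(\<lambda>_. 0) \<in> M"
          using scalar_closed_zero[OF P] scalar_closed_zero[OF GH]
          by (auto simp: M_def intro!: bexI[of _ "\<lambda>_. 0"])
      next
        fix g g' assume "g \<in> M"
          "g' \<in> M"
        then obtain p p' where *: "p \<in> P d" "p' \<in> P d"
            "(\<lambda>n. p n + g n * x ^ d) \<in> GH" "(\<lambda>n. p' n + g' n * x ^ d) \<in> GH"
          unfolding M_def by blast
        have "(\<lambda>n. (p n + p' n) + (g n + g' n) * x ^ d) \<in> GH"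
          using scalar_closed_add[OF GH *(3,4)] by (simp only: distrib_right add_ac)
        then show "(\<lambda>n. g n + g' n) \<in> M"
          by (rule MI[OF scalar_closed_add[OF P *(1,2)]])
      next
        fix g c assume "g \<in> M" and c: "c \<in> C"
        then obtain p where *: "p \<in> P d" "(\<lambda>n. p n + g n * x ^ d) \<in> GH"
          unfolding M_def by blast
        have "(\<lambda>n. p n * c + g n * c * x ^ d) \<in> GH"
          using scalar_closed_scale[OF GH_C *(2) c] by (simp only: distrib_right right_commute[of _ c "x ^ d"])
        then show "(\<lambda>n. g n * c) \<in> M"
          by (rule MI[OF scalar_closed_scale[OF P *(1) c]])
      qed
    qed
    with that(2) H(3) show ?thesis unfolding M_def by blast
  qed
  \<comment> \<open>Above degree \<open>D\<close> no new leading coefficients occur, so those of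
    degree \<open>D\<close> are carried up by powers of \<open>x\<close>.\<close>
  have high: "\<exists>p\<in>P (D + j). (\<lambda>n. p n + m n * x ^ (D + j)) \<in> GH" if "m \<in> Lead D" for m j
  proof (induction j)
    case 0
    then show ?case using low[OF order_refl that] by simp
  next
    case (Suc j)
    then obtain p where *: "p \<in> P (D + j)" "(\<lambda>n. p n + m n * x ^ (D + j)) \<in> GH" by blast
    have "(\<lambda>n. p n * x + m n * x ^ (D + Suc j)) \<in> GH"
      using scalar_closed_scale[OF GH *(2), of x]
      by (simp add: power_Suc2 distrib_right mult.assoc del: power_Suc)
    then show ?case using P_shift[OF *(1)] by auto
  qed
  have lead_GH: "\<exists>p\<in>P d. (\<lambda>n. p n + m n * x ^ d) \<in> GH" if "m \<in> Lead d" for d m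
  proof (cases "d \<le> D")
    case True
    then show ?thesis using low that by blast
  next
    case False
    then show ?thesis using high[of m "d - D"] that Lead_D by auto
  qed
  \<comment> \<open>Induction on the degree bound: an element of \<open>GH\<close> with the same
    leading coefficient as \<open>g\<close> is subtracted by means of \<open>e\<close>. The
    difference \<open>p + q * e\<close> is in \<open>N\<close> and in \<open>P d\<close>, so the
    induction hypothesis applies.\<close>
  have "g \<in> P d \<Longrightarrow> g \<in> N \<Longrightarrow> g \<in> GH" for g d
  proof (induction d arbitrary: g)
    case 0
    then show ?case using scalar_closed_zero[OF GH] by (simp add: P_def)
  next
    case (Suc d)
    then obtain p m where *: "p \<in> P d" "m \<in> X" "g = (\<lambda>n. p n + m n * x ^ d)"
      by (auto simp: P_def)
    then have "m \<in> Lead d" using Suc.prems unfolding Lead_def by blast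
    then obtain q where q: "q \<in> P d" "(\<lambda>n. q n + m n * x ^ d) \<in> GH" using lead_GH by blast
    have eq: "(\<lambda>n. p n + q n * e) = (\<lambda>n. g n + (q n + m n * x ^ d) * e)"
    proof
      fix n
      have "g n + (q n + m n * x ^ d) * e = p n + q n * e + (m n * x ^ d + m n * x ^ d * e)"
        by (simp only: *(3) distrib_right add_ac)
      then show "p n + q n * e = g n + (q n + m n * x ^ d) * e" by (simp add: plus_neg)
    qed
    have "(\<lambda>n. p n + q n * e) \<in> N"
      unfolding eq
      by (rule scalar_closed_add[OF N Suc.prems(2) scalar_closed_scale[OF N]])
        (use q(2) GH_N e in auto)
    moreover have "(\<lambda>n. p n + q n * e) \<in> P d"
      using e by (intro scalar_closed_add[OF P] scalar_closed_scale[OF P] * q)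
    ultimately have "(\<lambda>n. (q n + m n * x ^ d) + (p n + q n * e)) \<in> GH"
      by (intro scalar_closed_add[OF GH] q(2) Suc.IH)
    moreover have "(q n + m n * x ^ d) + (p n + q n * e) = g n" for n
      unfolding fun_cong[OF eq] by (rule plus_neg_cancel)
    ultimately show ?case by simp
  qed
  then have "N \<subseteq> GH" using N_P by blast
  with \<open>finite G\<close> \<open>G \<subseteq> N\<close>
  show "\<exists>G. finite G \<and> G \<subseteq> N \<and> N \<subseteq> scalar_closed (insert x C) hull G"
    unfolding GH_def by blast
qed

text \<open>The scalars are adjoined one at a time, with \<open>e\<close> kept present so that each
  step can subtract.\<close>

lemma noetherian_finite_scalars:
  fixes E :: "('n \<Rightarrow> 'k) set"
  assumes "finite C" "finite E"
  shows "noetherian (insert e C) (scalar_closed (insert e C) hull E)"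
  using assms(1)
proof (induction C rule: finite_induct)
  case empty
  show ?case using assms(2) by (rule noetherian_finite_generators)
next
  case (insert x C)
  then show ?case
    using noetherian_insert_scalar[of "insert e C" E x] by (simp add: insert_commute)
qed

end

section \<open>Words of a multidimensional numeration system\<close>

lemma parallel_row:
  fixes w :: "'d::finite \<Rightarrow> 'a list"
  shows "map (\<lambda>x. x i) (parallel h w) =
     replicate (Max (range (\<lambda>i. length (w i))) - length (w i)) h @ w i"
proof -
  have "length (w i) \<le> Max (range (\<lambda>i. length (w i)))"
    by (intro Max_ge) auto
  then show ?thesis
    by (intro nth_equalityI) (simp_all add: parallel_def Let_def)
qed

lemma length_parallel: "length (parallel h w) = Max (range (\<lambda>i. length (w i)))"
  by (simp add: parallel_def Let_def)

lemma rows_eqI: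
  assumes "\<And>i. map (\<lambda>x. x i) u = map (\<lambda>x. x i) v"
  shows "u = v"
proof (rule nth_equalityI)
  show "length u = length v" using arg_cong[OF assms, of length] by simp
  fix j assume "j < length u"
  with \<open>length u = length v\<close> show "u ! j = v ! j"
    using assms by (metis (no_types, lifting) ext nth_map)
qed

lemma dropWhile_padding: "h \<notin> set w \<Longrightarrow> dropWhile ((=) h) (replicate n h @ w) = w"
  by (induction n) (auto simp: dropWhile_eq_self_iff dest: hd_in_set)

text \<open>Removing the leading padding from each row recovers the component, because
  \<open>h\<close> does not occur in it.\<close>

lemma parallel_inject:
  assumes eq: "parallel h w = parallel h w'" and "\<And>i. h \<notin> set (w i)" "\<And>i. h \<notin> set (w' i)"
  shows "w = w'"
proof
  fix i
  show "w i = w' i"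
    using arg_cong[OF eq, of "\<lambda>v. dropWhile ((=) h) (map (\<lambda>x. x i) v)"] assms(2,3)
    by (simp add: parallel_row dropWhile_padding)
qed

text \<open>A prefix of length \<open>k\<close> first uses up the padding of a row. Truncated
  subtraction gives the empty word when the prefix ends inside the padding.\<close>

lemma take_parallel:
  fixes w :: "'d::finite \<Rightarrow> 'a list"
  defines "m \<equiv> Max (range (\<lambda>i. length (w i)))"
  assumes "k \<le> m"
  shows "take k (parallel h w) = parallel h (\<lambda>i. take (k - (m - length (w i))) (w i))"
proof (rule rows_eqI)
  fix i
  define u where "u i = take (k - (m - length (w i))) (w i)" for i
  have le: "length (w i) \<le> m" for i unfolding m_def by (intro Max_ge) auto
  have len: "length (u i) = k - (m - length (w i))" for i
    using \<open>k \<le> m\<close> le[of i] by (simp add: u_def)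
  \<comment> \<open>A longest row has no padding, so its truncation has length exactly
    \<open>k\<close> and the truncated tuple is padded to the length \<open>k\<close>.\<close>
  have "m \<in> range (\<lambda>i. length (w i))" unfolding m_def by (intro Max_in) auto
  then obtain i0 where "length (w i0) = m" by auto
  then have "length (u i0) = k" by (simp add: len)
  then have "k \<in> range (\<lambda>i. length (u i))" by blast
  then have "Max (range (\<lambda>i. length (u i))) = k"
    by (rule Max_eqI[rotated 2]) (auto simp: len)
  then have "map (\<lambda>x. x i) (parallel h u) = replicate (k - length (u i)) h @ u i"
    by (simp add: parallel_row)
  also have "\<dots> = take k (map (\<lambda>x. x i) (parallel h w))"
  proof -
    have "k - (k - (m - length (w i))) = min k (m - length (w i))" by simp
    then show ?thesis using len[of i] by (simp add: parallel_row m_def[symmetric] u_def del: length_take)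
  qed
  finally show "map (\<lambda>x. x i) (take k (parallel h w)) =
      map (\<lambda>x. x i) (parallel h (\<lambda>i. take (k - (m - length (w i))) (w i)))"
    by (simp add: u_def[abs_def] take_map)
qed

lemma multi_lang_take:
  assumes "\<And>i. prefix_closed (lang (S i))" "v \<in> multi_lang h S"
  shows "take k v \<in> multi_lang h S"
proof (cases "k \<le> length v")
  case True
  obtain w where w: "v = parallel h w" "\<And>i. w i \<in> lang (S i)"
    using assms(2) by (auto simp: multi_lang_def)
  have "take j (w i) \<in> lang (S i)" for i j
    using assms(1) w(2) unfolding prefix_closed_def by (meson take_is_prefix)
  then show ?thesis
    using True by (auto simp: w(1) length_parallel take_parallel multi_lang_def)
qed (use assms(2) in simp)

section \<open>Radix order and enumeration of the words of a language\<close>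

lemma lenlex_total_on_lists:
  assumes "total_on A r"
  shows "total_on (lists A) (lenlex r)"
proof (rule total_onI)
  fix u v assume "u \<in> lists A" "v \<in> lists A" "u \<noteq> v"
  then show "(u, v) \<in> lenlex r \<or> (v, u) \<in> lenlex r"
  proof (induction u arbitrary: v rule: list.induct)
    case Nil
    then show ?case by simp
  next
    case (Cons a u)
    show ?case
    proof (cases v)
      case Nil
      then show ?thesis by simp
    next
      case v: (Cons b v')
      have mem: "a \<in> A" "b \<in> A" "v' \<in> lists A" "u \<in> lists A" using Cons.prems v by simp_all
      show ?thesis
      proof (cases "a = b")
        case True
        then have "u \<noteq> v'" using Cons.prems v by simp
        with Cons.IH[OF mem(4,3)] show ?thesis by (auto simp: v True Cons_lenlex_iff)
      next
        case False
        then have "(a, b) \<in> r \<or> (b, a) \<in> r" using assms mem by (auto simp: total_on_def)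
        then show ?thesis
          by (cases "length u" "length v'" rule: linorder_cases) (auto simp: v Cons_lenlex_iff)
      qed
    qed
  qed
qed

text \<open>The rank is strictly increasing, hence injective. The predecessors of \<open>w\<close>
  have \<open>rk w\<close> distinct ranks below \<open>rk w\<close>, so they take all these values.
  The set of ranks is thus a downward closed infinite set of natural numbers.\<close>

lemma bij_betw_card_predecessors:
  assumes "infinite L" "\<And>w. w \<in> L \<Longrightarrow> finite {u \<in> L. (u, w) \<in> R}"
    and irrefl: "\<And>w. (w, w) \<notin> R" and "trans R" and tot: "total_on L R"
  shows "bij_betw (\<lambda>w. card {u \<in> L. (u, w) \<in> R}) L UNIV"
proof -
  define rk where "rk w = card {u \<in> L. (u, w) \<in> R}" for w
  have less: "rk u < rk w" if "u \<in> L" "w \<in> L" "(u, w) \<in> R" for u w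
    unfolding rk_def using that assms(2)[of w] irrefl transD[OF \<open>trans R\<close>]
    by (intro psubset_card_mono) blast+
  then have inj: "inj_on rk L"
    using tot unfolding total_on_def by (metis inj_onI less_irrefl)
  have down: "{..<rk w} \<subseteq> rk ` L" if "w \<in> L" for w
  proof -
    have "rk ` {u \<in> L. (u, w) \<in> R} \<subseteq> {..<rk w}" using less that by auto
    moreover have "card (rk ` {u \<in> L. (u, w) \<in> R}) = rk w"
      using inj by (subst card_image) (auto simp: rk_def intro: inj_on_subset)
    ultimately have "rk ` {u \<in> L. (u, w) \<in> R} = {..<rk w}"
      by (intro card_subset_eq) auto
    then show ?thesis by blast
  qed
  have "infinite (rk ` L)" using assms(1) inj by (simp add: finite_image_iff)
  then have "\<exists>w\<in>L. k < rk w" for k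
    unfolding finite_nat_set_iff_bounded_le by (metis image_iff not_le)
  then have "rk ` L = UNIV" using down by blast
  with inj show ?thesis unfolding bij_betw_def rk_def by blast
qed

text \<open>\<open>rep\<close> inverts the rank. Predecessors in the radix order are no longer than
  the word itself, so over a finite alphabet they are finite in number.\<close>

lemma rep_bij:
  assumes "abstract_numeration_system S"
  shows "bij_betw (rep S) UNIV (lang S)"
proof -
  define rk where "rk w = card {u \<in> lang S. (u, w) \<in> lenlex (alph_less S)}" for w
  have fin: "finite (alph S)" and lin: "strict_linear_order_on (alph S) (alph_less S)"
    and inf: "infinite (lang S)" and sub: "lang S \<subseteq> lists (alph S)"
    using assms by (auto simp: abstract_numeration_system_def regular_language_def)
  have bij: "bij_betw rk (lang S) UNIV"
    unfolding rk_def
  proof (rule bij_betw_card_predecessors[OF inf])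
    fix w
    have "{u \<in> lang S. (u, w) \<in> lenlex (alph_less S)}
        \<subseteq> {u. set u \<subseteq> alph S \<and> length u \<le> length w}"
      using sub lenlex_length by blast
    then show "finite {u \<in> lang S. (u, w) \<in> lenlex (alph_less S)}"
      using finite_lists_length_le[OF fin] by (rule finite_subset)
    show "(w, w) \<notin> lenlex (alph_less S)"
      using lin by (intro lenlex_irreflexive) (auto simp: strict_linear_order_on_def irrefl_def)
    show "trans (lenlex (alph_less S))"
      using lin by (auto simp: strict_linear_order_on_def)
    show "total_on (lang S) (lenlex (alph_less S))"
      using lenlex_total_on_lists[of "alph S" "alph_less S"] lin sub
      by (auto simp: strict_linear_order_on_def total_on_def)
  qed
  have "rep S = inv_into (lang S) rk"
    unfolding rep_def fun_eq_iff rk_def[symmetric]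
  proof (intro allI the_equality)
    fix n
    show "inv_into (lang S) rk n \<in> lang S \<and> rk (inv_into (lang S) rk n) = n"
      using bij by (metis UNIV_I bij_betw_imp_surj_on f_inv_into_f inv_into_into)
    show "w = inv_into (lang S) rk n" if "w \<in> lang S \<and> rk w = n" for w n
      using bij that by (metis bij_betw_inv_into_left)
  qed
  then show ?thesis
    using bij_betw_inv_into[OF bij] by simp
qed

section \<open>Representations of tuples\<close>

lemma inj_multi_rep:
  assumes "\<And>i. abstract_numeration_system (S i)" "h \<notin> (\<Union>i. alph (S i))"
  shows "inj (multi_rep h S)"
proof (rule injI)
  fix m n assume eq: "multi_rep h S m = multi_rep h S n"
  have "set (rep (S i) k) \<subseteq> alph (S i)" for i k
  proof -
    have "rep (S i) k \<in> lang (S i)"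
      using rep_bij[OF assms(1)] by (rule bij_betw_apply) simp
    then show ?thesis
      using assms(1)[of i] by (auto simp: abstract_numeration_system_def regular_language_def)
  qed
  then have "h \<notin> set (rep (S i) k)" for i k using assms(2) by blast
  then have "(\<lambda>i. rep (S i) (m i)) = (\<lambda>i. rep (S i) (n i))"
    using eq unfolding multi_rep_def by (intro parallel_inject) auto
  then show "m = n"
    using rep_bij[OF assms(1)] by (metis (no_types, lifting) bij_betw_imp_inj_on ext injD)
qed

lemma range_multi_rep:
  assumes "\<And>i. abstract_numeration_system (S i)"
  shows "range (multi_rep h S) = multi_lang h S"
proof
  show "range (multi_rep h S) \<subseteq> multi_lang h S"
    using bij_betw_apply[OF rep_bij[OF assms]] by (auto simp: multi_rep_def multi_lang_def)
  show "multi_lang h S \<subseteq> range (multi_rep h S)"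
  proof
    fix v assume "v \<in> multi_lang h S"
    then obtain w where w: "v = parallel h w" "\<And>i. w i \<in> lang (S i)"
      by (auto simp: multi_lang_def)
    have "\<forall>i. \<exists>k. w i = rep (S i) k"
      using rep_bij[OF assms] w(2) by (metis bij_betw_imp_surj_on rangeE)
    then obtain n where "\<And>i. w i = rep (S i) (n i)" by metis
    then have "w = (\<lambda>i. rep (S i) (n i))" by (rule ext)
    then have "v = multi_rep h S n" by (simp add: w(1) multi_rep_def)
    then show "v \<in> range (multi_rep h S)" by simp
  qed
qed

text \<open>The letter consisting of padding only never occurs, because a row of maximal length is
  unpadded.\<close>

lemma multi_lang_alphabet:
  fixes S :: "'d::finite \<Rightarrow> 'a numeration_system"
  assumes "\<And>i. abstract_numeration_system (S i)" "h \<notin> (\<Union>i. alph (S i))"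
  shows "multi_lang h S \<subseteq> lists (padded_alphabet h S)"
proof
  fix v assume "v \<in> multi_lang h S"
  then obtain w where v: "v = parallel h w" and "\<And>i. w i \<in> lang (S i)"
    by (auto simp: multi_lang_def)
  then have w: "set (w i) \<subseteq> alph (S i)" for i
    using assms(1)[of i] by (auto simp: abstract_numeration_system_def regular_language_def)
  define m where "m = Max (range (\<lambda>i. length (w i)))"
  have "m \<in> range (\<lambda>i. length (w i))" unfolding m_def by (intro Max_in) auto
  then obtain i0 where "length (w i0) = m" by auto
  then have "map (\<lambda>x. x i0) v = w i0" by (simp add: v parallel_row m_def[symmetric])
  then have "x i0 \<noteq> h" if "x \<in> set v" for x
    using that w[of i0] assms(2) by (metis UN_I UNIV_I image_eqI image_set subsetD)
  moreover have "x i \<in> alph (S i) \<union> {h}" if "x \<in> set v" for x i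
  proof -
    have "x i \<in> set (map (\<lambda>x. x i) v)" using that by auto
    then show ?thesis using w[of i] by (auto simp: v parallel_row split: if_splits)
  qed
  ultimately show "v \<in> lists (padded_alphabet h S)"
    by (auto simp: padded_alphabet_def)
qed

lemma finite_padded_alphabet:
  fixes S :: "'d::finite \<Rightarrow> 'a numeration_system"
  assumes "\<And>i. finite (alph (S i))"
  shows "finite (padded_alphabet h S)"
proof (rule finite_subset)
  show "padded_alphabet h S \<subseteq> Pi\<^sub>E UNIV (\<lambda>i. insert h (alph (S i)))"
    by (auto simp: padded_alphabet_def PiE_def)
  show "finite (Pi\<^sub>E UNIV (\<lambda>i. insert h (alph (S i))))"
    using assms by (intro finite_PiE) auto
qed

section \<open>Recognizable series and kernels\<close>

lemma mult_mat_entry: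
  assumes "M \<in> carrier_mat n m" "N \<in> carrier_mat m p" "i < n" "j < p"
  shows "(M * N) $$ (i, j) = (\<Sum>k<m. M $$ (i, k) * N $$ (k, j))"
  using assms by (simp add: scalar_prod_def atLeast0LessThan)

lemma one_mat_mult:
  fixes N :: "'k::{semiring_0,monoid_mult} mat"
  assumes "N \<in> carrier_mat r p"
  shows "1\<^sub>m r * N = N"
proof (rule eq_matI)
  fix i j assume "i < dim_row N" "j < dim_col N"
  then have ij: "i < r" "j < p" using assms by auto
  have "(1\<^sub>m r * N) $$ (i, j) = (\<Sum>k<r. 1\<^sub>m r $$ (i, k) * N $$ (k, j))"
    using ij assms by (intro mult_mat_entry) auto
  also have "\<dots> = (\<Sum>k<r. if k = i then N $$ (k, j) else 0)"
    using ij by (intro sum.cong) auto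
  also have "\<dots> = N $$ (i, j)" using ij by simp
  finally show "(1\<^sub>m r * N) $$ (i, j) = N $$ (i, j)" .
qed (use assms in auto)

text \<open>Reduces recognizability to the action of letters on coefficient columns: the fold
  computes the column of \<open>w\<close>, the last letter acting first.\<close>

lemma recognizableI:
  fixes M :: "'b \<Rightarrow> nat \<Rightarrow> nat \<Rightarrow> 'k::{semiring_0,monoid_mult}"
  assumes "r \<ge> 1"
    and s: "\<And>w. w \<in> lists A \<Longrightarrow>
      s w = (\<Sum>i<r. \<Lambda> i * foldr (\<lambda>a v i. \<Sum>j<r. M a i j * v j) w \<gamma> i)"
  shows "recognizable A s"
proof -
  define N where "N a = mat r r (\<lambda>(i, j). M a i j)" for a
  define \<mu> where "\<mu> w = foldr (\<lambda>a P. N a * P) w (1\<^sub>m r)" for w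
  define L where "L = mat 1 r (\<lambda>(i, j). \<Lambda> j)"
  define \<Gamma> where "\<Gamma> = mat r 1 (\<lambda>(i, j). \<gamma> i)"
  have N: "N a \<in> carrier_mat r r" for a by (simp add: N_def)
  have \<Gamma>: "\<Gamma> \<in> carrier_mat r 1" by (simp add: \<Gamma>_def)
  have L: "L \<in> carrier_mat 1 r" by (simp add: L_def)
  have \<mu>_Cons: "\<mu> (a # w) = N a * \<mu> w" for a w by (simp add: \<mu>_def)
  have \<mu>: "\<mu> w \<in> carrier_mat r r" for w
    by (induction w) (auto simp: \<mu>_def intro: mult_carrier_mat N)
  have append: "\<mu> (u @ v) = \<mu> u * \<mu> v" for u v
  proof (induction u)
    case Nil
    then show ?case using one_mat_mult[OF \<mu>] by (simp add: \<mu>_def)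
  next
    case (Cons a u)
    then show ?case using assoc_mult_mat[OF N \<mu> \<mu>] by (simp add: \<mu>_Cons)
  qed
  have entry: "i < r \<Longrightarrow> (\<mu> w * \<Gamma>) $$ (i, 0) = foldr (\<lambda>a v i. \<Sum>j<r. M a i j * v j) w \<gamma> i" for w i
  proof (induction w arbitrary: i)
    case Nil
    then show ?case using one_mat_mult[OF \<Gamma>] by (simp add: \<mu>_def) (simp add: \<Gamma>_def)
  next
    case (Cons a w)
    have "(\<mu> (a # w) * \<Gamma>) $$ (i, 0) = (N a * (\<mu> w * \<Gamma>)) $$ (i, 0)"
      using assoc_mult_mat[OF N \<mu> \<Gamma>] by (simp add: \<mu>_Cons)
    also have "\<dots> = (\<Sum>j<r. N a $$ (i, j) * (\<mu> w * \<Gamma>) $$ (j, 0))"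
      using Cons.prems by (intro mult_mat_entry[OF N mult_carrier_mat[OF \<mu> \<Gamma>]]) auto
    also have "\<dots> = foldr (\<lambda>a v i. \<Sum>j<r. M a i j * v j) (a # w) \<gamma> i"
      using Cons.prems by (simp add: Cons.IH N_def)
    finally show ?case .
  qed
  have "s w = (L * \<mu> w * \<Gamma>) $$ (0, 0)" if "w \<in> lists A" for w
  proof -
    have "(L * \<mu> w * \<Gamma>) $$ (0, 0) = (L * (\<mu> w * \<Gamma>)) $$ (0, 0)"
      by (simp only: assoc_mult_mat[OF L \<mu> \<Gamma>])
    also have "\<dots> = (\<Sum>i<r. L $$ (0, i) * (\<mu> w * \<Gamma>) $$ (i, 0))"
      by (intro mult_mat_entry[OF L mult_carrier_mat[OF \<mu> \<Gamma>]]) auto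
    also have "\<dots> = s w" by (simp add: s[OF that] entry L_def)
    finally show ?thesis by simp
  qed
  then show ?thesis
    unfolding recognizable_def
    using assms(1) \<mu> L \<Gamma> append
    by (intro exI[of _ r] conjI exI[of _ \<mu>] exI[of _ L] exI[of _ \<Gamma>]) (auto simp: \<mu>_def)
qed

text \<open>Splits a representation at a factorization of the word: \<open>g u\<close> is the row of
  the prefix, \<open>v w\<close> the column of the suffix, and \<open>M a\<close> the matrix of a
  letter.\<close>

lemma recognizableE:
  fixes s :: "'b list \<Rightarrow> 'k::{semiring_0,monoid_mult}"
  assumes "recognizable A s"
  obtains r :: nat and g v :: "'b list \<Rightarrow> nat \<Rightarrow> 'k" and M :: "'b \<Rightarrow> nat \<Rightarrow> nat \<Rightarrow> 'k"
  where "\<And>u w. u \<in> lists A \<Longrightarrow> w \<in> lists A \<Longrightarrow> s (u @ w) = (\<Sum>i<r. g u i * v w i)"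
    and "\<And>a w i. a \<in> A \<Longrightarrow> w \<in> lists A \<Longrightarrow> i < r \<Longrightarrow> v (a # w) i = (\<Sum>j<r. M a i j * v w j)"
proof -
  from assms obtain r and \<mu> :: "'b list \<Rightarrow> 'k mat" and L \<Gamma>
    where \<mu>: "\<And>w. w \<in> lists A \<Longrightarrow> \<mu> w \<in> carrier_mat r r"
      and append: "\<And>u v. u \<in> lists A \<Longrightarrow> v \<in> lists A \<Longrightarrow> \<mu> (u @ v) = \<mu> u * \<mu> v"
      and L: "L \<in> carrier_mat 1 r" and \<Gamma>: "\<Gamma> \<in> carrier_mat r 1"
      and s: "\<And>w. w \<in> lists A \<Longrightarrow> s w = (L * \<mu> w * \<Gamma>) $$ (0, 0)"
    unfolding recognizable_def by blast
  show thesis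
  proof (rule that)
    fix u w assume uw: "u \<in> lists A" "w \<in> lists A"
    have "L * \<mu> (u @ w) * \<Gamma> = (L * \<mu> u) * (\<mu> w * \<Gamma>)"
      using assoc_mult_mat[OF L \<mu>[OF uw(1)] \<mu>[OF uw(2)]]
        assoc_mult_mat[OF mult_carrier_mat[OF L \<mu>[OF uw(1)]] \<mu>[OF uw(2)] \<Gamma>]
      by (simp add: append uw)
    then have "s (u @ w) = ((L * \<mu> u) * (\<mu> w * \<Gamma>)) $$ (0, 0)"
      using s[of "u @ w"] uw by simp
    also have "\<dots> = (\<Sum>i<r. (L * \<mu> u) $$ (0, i) * (\<mu> w * \<Gamma>) $$ (i, 0))"
      using mult_carrier_mat[OF L \<mu>[OF uw(1)]] mult_carrier_mat[OF \<mu>[OF uw(2)] \<Gamma>]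
      by (rule mult_mat_entry) auto
    finally show "s (u @ w) = (\<Sum>i<r. (L * \<mu> u) $$ (0, i) * (\<mu> w * \<Gamma>) $$ (i, 0))" .
  next
    fix a w i assume aw: "a \<in> A" "w \<in> lists A" "i < r"
    then have a: "[a] \<in> lists A" by simp
    have "\<mu> (a # w) * \<Gamma> = \<mu> [a] * (\<mu> w * \<Gamma>)"
      using append[OF a aw(2)] assoc_mult_mat[OF \<mu>[OF a] \<mu>[OF aw(2)] \<Gamma>] by simp
    then show "(\<mu> (a # w) * \<Gamma>) $$ (i, 0) = (\<Sum>j<r. \<mu> [a] $$ (i, j) * (\<mu> w * \<Gamma>) $$ (j, 0))"
      using mult_mat_entry[OF \<mu>[OF a] mult_carrier_mat[OF \<mu>[OF aw(2)] \<Gamma>] aw(3)] by simp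
  qed
qed

section \<open>Kernels for an injective enumeration of a prefix-closed language\<close>

locale prefix_closed_numeration =
  fixes R :: "'n \<Rightarrow> 'b list" and A :: "'b set"
  assumes inj_R: "inj R"
    and range_R: "range R \<subseteq> lists A"
    and take_R: "\<And>v k. v \<in> range R \<Longrightarrow> take k v \<in> range R"
begin

definition series :: "('n \<Rightarrow> 'k::{semiring_0,monoid_mult}) \<Rightarrow> 'b list \<Rightarrow> 'k" where
  "series f w = (if w \<in> range R then f (inv_into UNIV R w) else 0)"

definition shift :: "('n \<Rightarrow> 'k::{semiring_0,monoid_mult}) \<Rightarrow> 'b list \<Rightarrow> 'n \<Rightarrow> 'k" where
  "shift f w = (\<lambda>n. series f (R n @ w))"

definition kernel :: "('n \<Rightarrow> 'k::{semiring_0,monoid_mult}) \<Rightarrow> ('n \<Rightarrow> 'k) set" where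
  "kernel f = shift f ` lists A"

lemma series_R: "series f (R n) = f n"
  using inj_R by (simp add: series_def)

lemma shift_Nil: "shift f [] = f"
  by (simp add: shift_def series_R)

text \<open>If \<open>u\<close> is outside the language then so is \<open>u @ w\<close> by
  prefix-closedness, and both sides vanish.\<close>

lemma series_shift: "series (shift f w) u = series f (u @ w)"
proof (cases "u \<in> range R")
  case True
  then obtain n where "u = R n" by blast
  then show ?thesis by (simp add: series_R shift_def)
next
  case False
  then have "u @ w \<notin> range R" using take_R[of "u @ w" "length u"] by auto
  with False show ?thesis by (simp add: series_def)
qed

lemma shift_shift: "shift (shift f w) u = shift f (u @ w)"
  by (simp add: shift_def series_shift[unfolded shift_def])

lemma shift_combination:
  "shift (\<lambda>n. \<Sum>i<r. b i n * c i) w = (\<lambda>n. \<Sum>i<(r::nat). shift (b i) w n * c i)"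
  by (simp add: shift_def series_def fun_eq_iff)

text \<open>Shifting by \<open>u\<close> is linear and maps the kernel into itself, so the preimage
  of the span is a submodule containing the kernel.\<close>

lemma shift_mem_kernel_span:
  assumes "g \<in> submodule_span (kernel f)" "u \<in> lists A"
  shows "shift g u \<in> submodule_span (kernel f)"
proof -
  note closed = submodule_span_closed[of "kernel f"]
  have "submodule_span (kernel f) \<subseteq> {g. shift g u \<in> submodule_span (kernel f)}"
  proof (rule submodule_span_least)
    show "kernel f \<subseteq> {g. shift g u \<in> submodule_span (kernel f)}"
    proof
      fix g assume "g \<in> kernel f"
      then obtain w where "w \<in> lists A" "g = shift f w" by (auto simp: kernel_def)
      then have "shift g u = shift f (u @ w)" "u @ w \<in> lists A"
        using assms(2) by (simp_all add: shift_shift)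
      then have "shift g u \<in> kernel f" by (simp add: kernel_def)
      then show "g \<in> {g. shift g u \<in> submodule_span (kernel f)}"
        using submodule_span_base by blast
    qed
    have zero: "shift (\<lambda>_. 0) u = (\<lambda>_. 0)"
      and add: "shift (\<lambda>n. g n + g' n) u = (\<lambda>n. shift g u n + shift g' u n)"
      and scale: "shift (\<lambda>n. g n * c) u = (\<lambda>n. shift g u n * c)" for g g' :: "'n \<Rightarrow> 'a" and c
      by (simp_all add: shift_def series_def fun_eq_iff)
    show "scalar_closed UNIV {g. shift g u \<in> submodule_span (kernel f)}"
      by (rule scalar_closedI)
        (simp_all add: zero add scale scalar_closed_zero[OF closed] scalar_closed_add[OF closed]
          scalar_closed_scale[OF closed])
  qed
  with assms(1) show ?thesis by blast
qed

lemma recognizable_if_finitely_generated: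
  fixes f :: "'n \<Rightarrow> 'k::{semiring_0,monoid_mult}"
  assumes "finitely_generated (submodule_span (kernel f))"
  shows "recognizable A (series f)"
proof -
  obtain G where G: "finite G" "submodule_span (kernel f) = submodule_span G"
    using assms by (auto simp: finitely_generated_def)
  \<comment> \<open>The zero sequence is added to the generators to ensure \<open>r \<ge> 1\<close>;
    it does not change the span.\<close>
  obtain b and r :: nat where b: "insert (\<lambda>_. 0) G = b ` {..<r}"
    using finite_imp_nat_seg_image_inj_on[of "insert (\<lambda>_. 0) G"] G(1)
    by (auto simp: lessThan_def)
  have r: "r \<ge> 1" using b by (cases r) auto
  have "insert (\<lambda>_. 0) G \<subseteq> submodule_span G"
    using scalar_closed_zero[OF submodule_span_closed] submodule_span_base by blast
  then have b_span: "b i \<in> submodule_span (kernel f)" if "i < r" for i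
    unfolding b G(2) using that by blast
  have coeffs: "\<exists>c. g = (\<lambda>n. \<Sum>i<r. b i n * c i)" if "g \<in> submodule_span (kernel f)" for g
  proof (rule submodule_span_finite_coeffs)
    have "G \<subseteq> submodule_span (b ` {..<r})" using b submodule_span_base by blast
    then have "submodule_span G \<subseteq> submodule_span (b ` {..<r})"
      using submodule_span_closed by (rule submodule_span_least)
    with that G(2) show "g \<in> submodule_span (b ` {..<r})" by blast
  qed
  have "f \<in> kernel f" unfolding kernel_def using shift_Nil by (metis image_eqI lists.Nil)
  then have "f \<in> submodule_span (kernel f)" using submodule_span_base by blast
  from coeffs[OF this] obtain \<gamma> where \<gamma>: "f = (\<lambda>n. \<Sum>i<r. b i n * \<gamma> i)" ..
  \<comment> \<open>\<open>M a j\<close> holds chosen coordinates of the shifted generator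
    \<open>b j\<close>; it is a column of the matrix of \<open>a\<close>, which explains the index
    order \<open>M a j i\<close> in \<open>step\<close>.\<close>
  define M where "M a j = (SOME c. shift (b j) [a] = (\<lambda>n. \<Sum>i<r. b i n * c i))" for a j
  have M: "shift (b j) [a] = (\<lambda>n. \<Sum>i<r. b i n * M a j i)" if "j < r" "a \<in> A" for j a
  proof -
    have "shift (b j) [a] \<in> submodule_span (kernel f)"
      using that by (intro shift_mem_kernel_span b_span) auto
    from someI_ex[OF coeffs[OF this]] show ?thesis unfolding M_def .
  qed
  define step where "step a v i = (\<Sum>j<r. M a j i * v j)" for a i and v :: "nat \<Rightarrow> 'k"
  have shift_w: "shift f w = (\<lambda>n. \<Sum>i<r. b i n * foldr step w \<gamma> i)" if "w \<in> lists A" for w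
    using that
  proof (induction w rule: list.induct)
    case Nil
    then show ?case using \<gamma> by (simp add: shift_Nil)
  next
    case (Cons a w)
    define v where "v = foldr step w \<gamma>"
    have "shift f (a # w) = shift (shift f w) [a]" by (simp add: shift_shift)
    also have "\<dots> = shift (\<lambda>n. \<Sum>i<r. b i n * v i) [a]"
      using Cons by (simp add: v_def)
    also have "\<dots> = (\<lambda>n. \<Sum>j<r. (\<Sum>i<r. b i n * M a j i) * v j)"
      unfolding shift_combination using Cons.prems M by (intro ext sum.cong) auto
    also have "\<dots> = (\<lambda>n. \<Sum>i<r. b i n * step a v i)"
      unfolding step_def sum_distrib_left sum_distrib_right mult.assoc
      by (intro ext sum.swap)
    finally show ?case by (simp add: v_def)
  qed
  \<comment> \<open>At the index \<open>n0\<close> of the empty word, \<open>shift f w\<close> takes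
    the value of the series at \<open>w\<close>. The row vector of the representation therefore has
    the entries \<open>b i n0\<close>.\<close>
  have "[] \<in> range R" using take_R[of "R undefined" 0] by simp
  then obtain n0 where n0: "R n0 = []" by (metis imageE)
  have step_eq: "step = (\<lambda>a v i. \<Sum>j<r. M a j i * v j)" by (simp add: step_def fun_eq_iff)
  show ?thesis
  proof (rule recognizableI[OF r])
    fix w assume "w \<in> lists A"
    from fun_cong[OF shift_w[OF this], of n0]
    show "series f w = (\<Sum>i<r. b i n0 * foldr (\<lambda>a v i. \<Sum>j<r. M a j i * v j) w \<gamma> i)"
      by (simp add: shift_def n0 step_eq)
  qed
qed

lemma finitely_generated_if_recognizable:
  fixes f :: "'n \<Rightarrow> 'k::{semiring_0,monoid_mult}"
  assumes rec: "recognizable A (series f)" and "finite A"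
    and K: "finite (UNIV :: 'k set) \<or>
      ((\<forall>x y :: 'k. x * y = y * x) \<and> (\<forall>x :: 'k. \<exists>y. x + y = 0))"
  shows "finitely_generated (submodule_span (kernel f))"
proof -
  from rec obtain r :: nat and g v :: "'b list \<Rightarrow> nat \<Rightarrow> 'k" and M
    where sum: "\<And>u w. u \<in> lists A \<Longrightarrow> w \<in> lists A \<Longrightarrow>
        series f (u @ w) = (\<Sum>i<r. g u i * v w i)"
    and v_Cons: "\<And>a w i. a \<in> A \<Longrightarrow> w \<in> lists A \<Longrightarrow> i < r \<Longrightarrow>
        v (a # w) i = (\<Sum>j<r. M a i j * v w j)"
    by (rule recognizableE) (rule that)
  have shift_w: "shift f w = (\<lambda>n. \<Sum>i<r. g (R n) i * v w i)" if "w \<in> lists A" for w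
    unfolding shift_def using that range_R by (intro ext sum) auto
  from K show ?thesis
  proof
    assume fin: "finite (UNIV :: 'k set)"
    \<comment> \<open>Each shift is determined by its column of \<open>r\<close> coefficients, and
      over a finite semiring there are only finitely many columns.\<close>
    have "kernel f \<subseteq> (\<lambda>c n. \<Sum>i<r. g (R n) i * c i) ` Pi\<^sub>E {..<r} (\<lambda>_. UNIV)"
    proof
      fix p assume "p \<in> kernel f"
      then obtain w where w: "w \<in> lists A" "p = shift f w" by (auto simp: kernel_def)
      then show "p \<in> (\<lambda>c n. \<Sum>i<r. g (R n) i * c i) ` Pi\<^sub>E {..<r} (\<lambda>_. UNIV)"
        by (intro image_eqI[where x = "restrict (v w) {..<r}"]) (simp_all add: shift_w)
    qed
    moreover have "finite (Pi\<^sub>E {..<r} (\<lambda>_. UNIV :: 'k set))"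
      using fin by (intro finite_PiE) auto
    ultimately have "finite (kernel f)" by (meson finite_imageI finite_subset)
    then show ?thesis by (auto simp: finitely_generated_def)
  next
    assume ring: "(\<forall>x y :: 'k. x * y = y * x) \<and> (\<forall>x :: 'k. \<exists>y. x + y = 0)"
    then obtain e :: 'k where "1 + e = 0" by blast
    then interpret commutative_scalars e using ring by unfold_locales auto
    \<comment> \<open>The entries of the letter matrices and of the final column
      \<open>v []\<close>, together with \<open>e\<close>; the set is finite because
      \<open>A\<close> is.\<close>
    define C where "C = insert e ((\<lambda>(a, i, j). M a i j) ` (A \<times> {..<r} \<times> {..<r}) \<union> v [] ` {..<r})"
    define E where "E = (\<lambda>i n. g (R n) i) ` {..<r}"
    define X where "X = scalar_closed C hull E"
    have X: "scalar_closed C X" by (simp add: X_def scalar_closed_hull)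
    have noeth: "noetherian C X"
      unfolding X_def C_def E_def using \<open>finite A\<close> by (intro noetherian_finite_scalars) auto
    \<comment> \<open>The scalars that preserve \<open>X\<close> contain \<open>C\<close> and are
      closed under sums and products. They stand in for the subring generated by \<open>C\<close>,
      in which all entries of the columns \<open>v w\<close> lie.\<close>
    define Q where "Q = {c. \<forall>p\<in>X. (\<lambda>n. p n * c) \<in> X}"
    have Q_C: "c \<in> Q" if "c \<in> C" for c
      using scalar_closed_scale[OF X _ that] by (simp add: Q_def)
    have Q_mult: "x * y \<in> Q" if "x \<in> Q" "y \<in> Q" for x y
      using that by (simp add: Q_def mult.assoc[symmetric])
    have Q_sum: "(\<Sum>j<k. q j) \<in> Q" if "\<And>j. j < k \<Longrightarrow> q j \<in> Q" for k :: nat and q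
      using that by (auto simp: Q_def sum_distrib_left intro!: scalar_closed_sum[OF X])
    have v_Q: "i < r \<Longrightarrow> v w i \<in> Q" if "w \<in> lists A" for w i
      using that
    proof (induction w arbitrary: i rule: list.induct)
      case Nil
      then show ?case by (intro Q_C) (auto simp: C_def)
    next
      case (Cons a w)
      then have "M a i j \<in> Q" if "j < r" for j using that by (intro Q_C) (force simp: C_def)
      moreover have "v w j \<in> Q" if "j < r" for j using Cons that by simp
      ultimately have "(\<Sum>j<r. M a i j * v w j) \<in> Q" by (intro Q_sum Q_mult)
      with Cons show ?case by (simp add: v_Cons)
    qed
    have "shift f w \<in> X" if "w \<in> lists A" for w
      unfolding shift_w[OF that]
    proof (rule scalar_closed_sum[OF X])
      fix i assume "i < r"
      then have "(\<lambda>n. g (R n) i) \<in> X" unfolding X_def E_def by (intro hull_inc) auto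
      then show "(\<lambda>n. g (R n) i * v w i) \<in> X" using v_Q[OF that \<open>i < r\<close>] by (auto simp: Q_def)
    qed
    then have "kernel f \<subseteq> X" by (auto simp: kernel_def)
    then have "scalar_closed C hull (kernel f) \<subseteq> X" using X by (rule scalar_closed_hull_least)
    \<comment> \<open>The Noetherian property is applied over \<open>C\<close> to the module
      generated by the kernel. Enlarging the scalars to all of the ring then turns \<open>G\<close>
      into generators of the full span.\<close>
    from noeth this scalar_closed_hull obtain G where G: "finite G"
        "G \<subseteq> scalar_closed C hull (kernel f)"
        "scalar_closed C hull (kernel f) \<subseteq> scalar_closed C hull G"
      by (rule noetherianD)
    have hull_span: "scalar_closed C hull Y \<subseteq> submodule_span Y" for Y :: "('n \<Rightarrow> 'k) set"
      by (rule scalar_closed_hull_least[OF submodule_span_base scalar_closed_mono[OF subset_UNIV]])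
        (rule submodule_span_closed)
    have "submodule_span (kernel f) \<subseteq> submodule_span G"
    proof (rule submodule_span_least[OF _ submodule_span_closed])
      show "kernel f \<subseteq> submodule_span G"
        using hull_subset[of "kernel f"] G(3) hull_span[of G] by blast
    qed
    moreover have "submodule_span G \<subseteq> submodule_span (kernel f)"
      using G(2) hull_span[of "kernel f"]
      by (intro submodule_span_least[OF _ submodule_span_closed]) blast
    ultimately show ?thesis
      using G(1) unfolding finitely_generated_def by (intro exI[of _ G]) simp
  qed
qed

end

section \<open>Transfer to multidimensional abstract numeration systems\<close>

theorem theorem5p11:
  fixes S :: "'d::finite \<Rightarrow> 'a numeration_system"
    and h :: 'a
    and f :: "('d \<Rightarrow> nat) \<Rightarrow> 'k::{semiring_0,monoid_mult}"
  assumes "\<And>i. abstract_numeration_system (S i)"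
    and "h \<notin> (\<Union>i. alph (S i))"
    and "\<And>i. prefix_closed (lang (S i))"
  shows "(finitely_generated (submodule_span (seq_kernel h S f)) \<longrightarrow> regular_sequence h S f) \<and>
         (regular_sequence h S f \<and>
            (finite (UNIV :: 'k set) \<or>
             ((\<forall>x y :: 'k. x * y = y * x) \<and> (\<forall>x :: 'k. \<exists>y. x + y = 0)))
          \<longrightarrow> finitely_generated (submodule_span (seq_kernel h S f)))"
proof -
  note range = range_multi_rep[of S h, OF assms(1)]
  interpret prefix_closed_numeration "multi_rep h S" "padded_alphabet h S"
  proof
    show "inj (multi_rep h S)" by (rule inj_multi_rep[OF assms(1,2)])
    show "range (multi_rep h S) \<subseteq> lists (padded_alphabet h S)"
      unfolding range by (rule multi_lang_alphabet[OF assms(1,2)])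
    show "take k v \<in> range (multi_rep h S)" if "v \<in> range (multi_rep h S)" for v k
      using that unfolding range by (rule multi_lang_take[OF assms(3)])
  qed
  \<comment> \<open>The range of \<open>multi_rep h S\<close> is \<open>multi_lang h S\<close> and
    its inverse is \<open>multi_val h S\<close>, so the abstract series, and with it the kernel, is
    the concrete one.\<close>
  have series_eq: "series f = (\<lambda>w. if w \<in> multi_lang h S then f (multi_val h S w) else 0)"
    by (simp add: series_def fun_eq_iff range multi_val_def)
  have "regular_sequence h S f \<longleftrightarrow> recognizable (padded_alphabet h S) (series f)"
    by (simp add: regular_sequence_def series_eq)
  moreover have "seq_kernel h S f = kernel f"
    by (auto simp: seq_kernel_def kernel_def shift_def shift_seq_def series_eq)
  moreover have "finite (padded_alphabet h S)"
    using assms(1) by (intro finite_padded_alphabet) (simp add: abstract_numeration_system_def)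
  ultimately show ?thesis
    using recognizable_if_finitely_generated[of f] finitely_generated_if_recognizable[of f] by simp
qed

end
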